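(* Let $a$ and $\ell$ be two layers (the anchor layer and a later layer) with real routing score matrices $S^a, S^\ell \in \mathbb{R}^{n_q\times n_k}$, let $1\le k<n_k$, and let $i\in\{1,\dots,n_q\}$ be a query row. Let $\mathcal{R}_i^a$ and $\mathcal{R}_i^\ell$ be the top-$k$ routes of row $i$ at layers $a$ and $\ell$, and let $$\Delta_i^a=\min_{j\in\mathcal{R}_i^a}S_{ij}^a-\max_{j\notin\mathcal{R}_i^a}S_{ij}^a$$ be the anchor margin of row $i$. If $\epsilon_i\in\mathbb{R}$ satisfies $$\max_{1\le j\le n_k}\left|S_{ij}^\ell-S_{ij}^a\right|\le\epsilon_i \quad\text{and}\quad \Delta_i^a>2\epsilon_i,$$ then $\mathcal{R}_i^\ell=\mathcal{R}_i^a$.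
   Context: At each layer $\ell$, query-chunk representations $Q_c^\ell\in\mathbb{R}^{n_q\times d}$ and key-chunk representations $K_c^\ell\in\mathbb{R}^{n_k\times d}$ define the routing score matrix $S^\ell=Q_c^\ell(K_c^\ell)^\top\in\mathbb{R}^{n_q\times n_k}$. For a query row $i$, the top-$k$ route $\mathcal{R}_i^\ell=\operatorname{TopK}_j(S_{ij}^\ell,k)\subseteq\{1,\dots,n_k\}$ is a set of exactly $k$ column indices with the largest scores in row $i$, that is, $|\mathcal{R}_i^\ell|=k$ and $S_{ij}^\ell\ge S_{ij'}^\ell$ for all $j\in\mathcal{R}_i^\ell$ and $j'\notin\mathcal{R}_i^\ell$ (ties, if any, are broken arbitrarily). *)

theory Defs
  imports "HOL-Analysis.Analysis"
begin

(* A score matrix with n_q rows and n_k columns is S :: real^'nk^'nq, so S $ i $ j is the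
   entry in row i and column j, n_q = CARD('nq) and n_k = CARD('nk).  Ties make the top-k
   set non-unique, hence a predicate on column sets rather than a function. *)
definition is_topk_route :: "real^'nk^'nq \<Rightarrow> 'nq \<Rightarrow> nat \<Rightarrow> 'nk set \<Rightarrow> bool" where
  "is_topk_route S i k R \<longleftrightarrow>
     card R = k \<and> (\<forall>j\<in>R. \<forall>j'. j' \<notin> R \<longrightarrow> S $ i $ j \<ge> S $ i $ j')"

(* Meaningful only if R and its complement are both nonempty. *)
definition route_margin :: "real^'nk^'nq \<Rightarrow> 'nq \<Rightarrow> 'nk set \<Rightarrow> real" where
  "route_margin S i R = (MIN j\<in>R. S $ i $ j) - (MAX j\<in>-R. S $ i $ j)"

end

theory Submission
  imports Defs
begin

text \<open>Moving each score by at most \<open>\<epsilon>\<close> changes the difference of two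
  scores by at most \<open>2 * \<epsilon>\<close>, so a larger gap keeps its sign. If the routes
  differed, some \<open>j\<close> would be dropped from \<open>Ra\<close> in favour of some
  \<open>j'\<close> outside it; the margin keeps \<open>j\<close> strictly above \<open>j'\<close>
  in \<open>Sl\<close>, against the choice of \<open>Rl\<close>.\<close>

theorem lemma1:
  fixes Sa Sl :: "real^'nk^'nq"
    and i :: 'nq
    and k :: nat
    and Ra Rl :: "'nk set"
    and \<epsilon> :: real
  assumes "1 \<le> k" and "k < CARD('nk)"
    and "is_topk_route Sa i k Ra"
    and "is_topk_route Sl i k Rl"
    and "(MAX j. \<bar>Sl $ i $ j - Sa $ i $ j\<bar>) \<le> \<epsilon>"
    and "route_margin Sa i Ra > 2 * \<epsilon>"
  shows "Rl = Ra"
proof (rule ccontr)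
  assume "Rl \<noteq> Ra"
  have card: "card Rl = card Ra"
    using assms(3,4) by (simp add: is_topk_route_def)
  \<comment> \<open>Distinct finite sets of equal size: neither contains the other, so both
    differences are inhabited.\<close>
  obtain j where j: "j \<in> Ra" "j \<notin> Rl"
    using card_subset_eq[of Rl Ra] card \<open>Rl \<noteq> Ra\<close> by auto
  obtain j' where j': "j' \<in> Rl" "j' \<notin> Ra"
    using card_subset_eq[of Ra Rl] card \<open>Rl \<noteq> Ra\<close> by auto
  have close: "\<bar>Sl $ i $ m - Sa $ i $ m\<bar> \<le> \<epsilon>" for m
  proof -
    have "\<bar>Sl $ i $ m - Sa $ i $ m\<bar> \<le> (MAX j. \<bar>Sl $ i $ j - Sa $ i $ j\<bar>)"
      by (rule Max_ge) auto
    then show ?thesis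
      using assms(5) by linarith
  qed
  \<comment> \<open>The margin is the smallest gap across the boundary of \<open>Ra\<close>, hence a
    lower bound for the gap of this pair.\<close>
  have "(MIN j\<in>Ra. Sa $ i $ j) \<le> Sa $ i $ j"
    using j by (intro Min_le) auto
  moreover have "Sa $ i $ j' \<le> (MAX j\<in>-Ra. Sa $ i $ j)"
    using j' by (intro Max_ge) auto
  ultimately have "Sa $ i $ j - Sa $ i $ j' > 2 * \<epsilon>"
    using assms(6) by (simp add: route_margin_def)
  then have "Sl $ i $ j' < Sl $ i $ j"
    using close[of j] close[of j'] by linarith
  moreover have "Sl $ i $ j \<le> Sl $ i $ j'"
    using assms(4) j j' by (simp add: is_topk_route_def)
  ultimately show False
    by simp
qed

end
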